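(* Let $p>1$. For every $v\in C^1([0,1])$ such that $v'(0)=v'(1)=0$ and $\phi_p(v')\in C^1([0,1])$, it holds $$\|\phi_p(v')\|_\infty^{\frac{p}{p-1}}\le4\gamma_p\,\|v\|_\infty\,\|(\phi_p(v'))'\|_\infty,$$ where $\gamma_p=1/(p-1)$ if $1<p<2$ and $\gamma_p=1$ if $p\ge2$.
   Context: $\phi_p(s)=|s|^{p-2}s$ for $s\in\mathbb R$ (with $\phi_p(0)=0$), and $\|\cdot\|_\infty$ is the supremum norm on $[0,1]$; functions are real valued. *)

theory Defs
  imports "HOL-Analysis.Analysis"
begin

definition phi :: "real \<Rightarrow> real \<Rightarrow> real" where
  "phi p s = \<bar>s\<bar> powr (p - 2) * s"

definition gam :: "real \<Rightarrow> real" where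
  "gam p = (if p < 2 then 1 / (p - 1) else 1)"

text \<open>The derivative on \<open>[0,1]\<close> is taken within the interval, hence one-sided at the endpoints.
  For this reason the library predicate \<open>C1_differentiable_on\<close>, which uses the two-sided
  derivative \<open>at x\<close>, is not suitable here.\<close>

definition D01 :: "(real \<Rightarrow> real) \<Rightarrow> real \<Rightarrow> real" where
  "D01 f x = vector_derivative f (at x within {0..1})"

definition C1_01 :: "(real \<Rightarrow> real) \<Rightarrow> bool" where
  "C1_01 f \<longleftrightarrow> f differentiable_on {0..1} \<and> continuous_on {0..1} (D01 f)"

text \<open>Only applied below to functions continuous on \<open>[0,1]\<close>, for which the supremum is
  taken over a bounded set.\<close>

definition supnorm01 :: "(real \<Rightarrow> real) \<Rightarrow> real" where
  "supnorm01 f = (SUP x\<in>{0..1}. \<bar>f x\<bar>)"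

end

theory Submission imports Defs begin

text \<open>Write \<open>w = \<phi>\<^sub>p(v')\<close> and \<open>q = p/(p-1)\<close>, the conjugate exponent of \<open>p\<close>. The exponent \<open>q\<close> is
  the right one because \<open>\<phi>\<^sub>q\<close> inverts \<open>\<phi>\<^sub>p\<close>: where \<open>v' > 0\<close> one has \<open>w\<^sup>q\<^sup>-\<^sup>1 = v'\<close>, hence
  \<open>(w\<^sup>q)' = q v' w' \<le> q M v'\<close> with \<open>M = \<parallel>w'\<parallel>\<^sub>\<infinity>\<close>. So \<open>w\<^sup>q - q M v\<close> is nonincreasing on every
  interval where \<open>v' > 0\<close>.

  Suppose \<open>\<bar>w\<bar>\<close> attains its maximum at \<open>x\<close>, and that \<open>v' x > 0\<close>. Going left from \<open>x\<close> to the
  nearest zero \<open>a\<close> of \<open>v'\<close>, which exists because \<open>v' 0 = 0\<close>, monotonicity gives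
  \<open>(w x)\<^sup>q \<le> q M (v x - v a) \<le> 2 q M \<parallel>v\<parallel>\<^sub>\<infinity>\<close>. This is \<open>phi_deriv_powr_le\<close>; the case \<open>v' x < 0\<close>
  is the same statement for \<open>-v\<close>. Finally \<open>2 q \<le> 4 \<gamma>\<^sub>p\<close>: for \<open>p \<ge> 2\<close> because \<open>q \<le> 2\<close>, and
  for \<open>p < 2\<close> because then \<open>q \<le> 2/(p-1)\<close>.\<close>

lemma phi_pos_eq_powr: "phi p s = s powr (p - 1)" if "s > 0"
  using that powr_add[of s "p - 2" 1] by (simp add: phi_def)

lemma phi_minus: "phi p (- s) = - phi p s"
  by (simp add: phi_def)

lemma phi_conjugate_powr:
  assumes "p > 1" "s > 0"
  shows "phi p s powr (p / (p - 1) - 1) = s"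
proof -
  have "(p - 1) * (p / (p - 1) - 1) = 1"
    using assms by (simp add: field_simps)
  then show ?thesis
    using assms by (simp add: phi_pos_eq_powr powr_powr)
qed

text \<open>The left end of the component of \<open>{u > 0}\<close> that contains \<open>x\<close>.\<close>

lemma nearest_zero_left:
  fixes u :: "real \<Rightarrow> real"
  assumes "b \<le> x" "continuous_on {b..x} u" "u b = 0" "u x > 0"
  obtains a where "b \<le> a" "a < x" "u a = 0" "\<And>y. a < y \<Longrightarrow> y \<le> x \<Longrightarrow> u y > 0"
proof -
  define Z where "Z = {y \<in> {b..x}. u y = 0}"
  have "closed Z"
    unfolding Z_def using assms(2) by (intro continuous_closed_preimage_constant) auto
  then have "compact Z"
    using compact_Int_closed[of "{b..x}" Z] by (simp add: Z_def Int_def conj_commute cong: conj_cong)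
  moreover have "b \<in> Z"
    using assms by (simp add: Z_def)
  ultimately obtain a where a: "a \<in> Z" "\<And>y. y \<in> Z \<Longrightarrow> y \<le> a"
    using compact_attains_sup[of Z] by blast
  have "u y > 0" if y: "a < y" "y \<le> x" for y
  proof (rule ccontr)
    assume "\<not> u y > 0"
    moreover have "continuous_on {y..x} u"
      using assms(2) by (rule continuous_on_subset) (use a(1) y in \<open>auto simp: Z_def\<close>)
    ultimately obtain z where "y \<le> z" "z \<le> x" "u z = 0"
      using IVT'[of u y 0 x] assms(4) y by auto
    then have "z \<in> Z"
      using a(1) y by (simp add: Z_def)
    with a(2) \<open>y \<le> z\<close> y show False
      by force
  qed
  moreover have "a < x"
    using a(1) assms(4) by (cases "a = x") (auto simp: Z_def)
  ultimately show ?thesis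
    using that a(1) by (auto simp: Z_def)
qed

text \<open>The estimate at one point. Derivatives appear as explicit functions \<open>u\<close> and \<open>w'\<close>, so that
  the lemma applies equally to \<open>v\<close> and to \<open>-v\<close>.\<close>

lemma phi_deriv_powr_le:
  fixes v u w' :: "real \<Rightarrow> real"
  assumes p: "p > 1"
    and v: "\<And>y. y \<in> {0..1} \<Longrightarrow> (v has_real_derivative u y) (at y within {0..1})"
    and u: "continuous_on {0..1} u" "u 0 = 0"
    and w: "\<And>y. y \<in> {0..1} \<Longrightarrow> ((\<lambda>y. phi p (u y)) has_real_derivative w' y) (at y within {0..1})"
    and N: "\<And>y. y \<in> {0..1} \<Longrightarrow> \<bar>v y\<bar> \<le> N"
    and M: "\<And>y. y \<in> {0..1} \<Longrightarrow> \<bar>w' y\<bar> \<le> M"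
    and x: "x \<in> {0..1}" "u x > 0"
  shows "phi p (u x) powr (p / (p - 1)) \<le> 2 * (p / (p - 1)) * N * M"
proof -
  define q where "q = p / (p - 1)"
  have q: "q > 0"
    using p by (simp add: q_def)
  have M0: "M \<ge> 0"
    using M[OF x(1)] by linarith
  have "continuous_on {0..x} u"
    using u(1) by (rule continuous_on_subset) (use x in auto)
  then obtain a where a: "0 \<le> a" "a < x" "u a = 0" and pos: "\<And>y. a < y \<Longrightarrow> y \<le> x \<Longrightarrow> u y > 0"
    using nearest_zero_left[of 0 x u] x u(2) by auto
  have sub: "{a..x} \<subseteq> {0..1}"
    using a x by auto
  define F where "F = (\<lambda>y. phi p (u y) powr q - q * M * v y)"
  have "F x \<le> F a"
  proof (rule DERIV_nonpos_imp_decreasing_open[of a x F])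
    show "a \<le> x"
      using a by simp
    fix y assume y: "a < y" "y < x"
    have y01: "y \<in> {0..1}" "at y within {0..1} = at y"
      using y a x by (auto intro!: at_within_Icc_at)
    have uy: "u y > 0"
      using pos y by simp
    have wy: "phi p (u y) > 0"
      using uy by (simp add: phi_pos_eq_powr)
    have "((\<lambda>y. phi p (u y)) has_real_derivative w' y) (at y)"
      using w[OF y01(1)] y01 by simp
    then have "((\<lambda>y. phi p (u y) powr q) has_real_derivative
        q * phi p (u y) powr (q - 1) * w' y) (at y)"
      using DERIV_fun_powr[of "\<lambda>y. phi p (u y)" "w' y" y q] wy by simp
    then have "((\<lambda>y. phi p (u y) powr q) has_real_derivative q * u y * w' y) (at y)"
      using phi_conjugate_powr[OF p uy] by (simp add: q_def)
    moreover have "(v has_real_derivative u y) (at y)"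
      using v[OF y01(1)] y01 by simp
    ultimately have "(F has_real_derivative q * u y * w' y - q * M * u y) (at y)"
      unfolding F_def by (intro DERIV_diff DERIV_cmult)
    moreover have "q * u y * w' y \<le> q * u y * M"
      using M[OF y01(1)] q uy by (intro mult_left_mono) auto
    ultimately show "\<exists>d. (F has_real_derivative d) (at y) \<and> d \<le> 0"
      by (intro exI[of _ "q * u y * w' y - q * M * u y"]) (simp add: mult_ac)
  next
    have "continuous_on {a..x} v" "continuous_on {a..x} (\<lambda>y. phi p (u y))"
      using DERIV_continuous_on[OF v] DERIV_continuous_on[OF w] sub
      by (auto intro: continuous_on_subset)
    moreover have "phi p (u y) \<ge> 0" if "y \<in> {a..x}" for y
      using that a(3) pos[of y] by (cases "y = a") (auto simp: phi_def)
    ultimately show "continuous_on {a..x} F"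
      unfolding F_def using q by (intro continuous_intros continuous_on_powr') auto
  qed
  then have "phi p (u x) powr q \<le> q * M * (v x - v a)"
    using a(3) by (simp add: F_def phi_def algebra_simps)
  also have "\<dots> \<le> q * M * (2 * N)"
    using N[of x] N[of a] x a M0 q by (intro mult_left_mono) auto
  finally show ?thesis
    by (simp add: q_def mult_ac)
qed

lemma C1_01_has_real_derivative:
  assumes "C1_01 f" "x \<in> {0..1}"
  shows "(f has_real_derivative D01 f x) (at x within {0..1})"
  using assms vector_derivative_works[of f "at x within {0..1}"]
  by (auto simp: C1_01_def D01_def differentiable_on_def
      has_real_derivative_iff_has_vector_derivative)

lemma C1_01_imp_continuous_on: "C1_01 f \<Longrightarrow> continuous_on {0..1} f"
  by (simp add: C1_01_def differentiable_imp_continuous_on)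

lemma supnorm01_attained:
  assumes "continuous_on {0..1} f"
  obtains x where "x \<in> {0..1}" "supnorm01 f = \<bar>f x\<bar>" "\<And>y. y \<in> {0..1} \<Longrightarrow> \<bar>f y\<bar> \<le> \<bar>f x\<bar>"
proof -
  have "continuous_on {0..1} (\<lambda>x. \<bar>f x\<bar>)"
    using assms by (intro continuous_intros)
  then obtain x where x: "x \<in> {0..1}" "\<And>y. y \<in> {0..1} \<Longrightarrow> \<bar>f y\<bar> \<le> \<bar>f x\<bar>"
    using continuous_attains_sup[of "{0..1::real}" "\<lambda>x. \<bar>f x\<bar>"] by auto
  then have "supnorm01 f = \<bar>f x\<bar>"
    unfolding supnorm01_def by (intro cSup_eq_maximum) auto
  with x that show ?thesis
    by blast
qed

lemma abs_le_supnorm01: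
  assumes "continuous_on {0..1} f" "x \<in> {0..1}"
  shows "\<bar>f x\<bar> \<le> supnorm01 f"
  by (rule supnorm01_attained[OF assms(1)]) (use assms(2) in auto)

lemma conjugate_exponent_le_gam: "2 * (p / (p - 1)) \<le> 4 * gam p" if "p > 1"
  using that by (auto simp: gam_def divide_simps)

theorem lemma3p2:
  fixes p :: real and v :: "real \<Rightarrow> real"
  assumes "p > 1"
    and "C1_01 v"
    and "D01 v 0 = 0" and "D01 v 1 = 0"
    and "C1_01 (\<lambda>x. phi p (D01 v x))"
  shows "supnorm01 (\<lambda>x. phi p (D01 v x)) powr (p / (p - 1))
    \<le> 4 * gam p * supnorm01 v * supnorm01 (D01 (\<lambda>x. phi p (D01 v x)))"
proof -
  define u where "u = D01 v"
  define w where "w = (\<lambda>x. phi p (u x))"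
  define N where "N = supnorm01 v"
  define M where "M = supnorm01 (D01 w)"
  have w_C1: "C1_01 w"
    using assms(5) by (simp add: w_def u_def)
  have v': "(v has_real_derivative u y) (at y within {0..1})" if "y \<in> {0..1}" for y
    using C1_01_has_real_derivative[OF assms(2) that] by (simp add: u_def)
  have w': "((\<lambda>y. phi p (u y)) has_real_derivative D01 w y) (at y within {0..1})"
    if "y \<in> {0..1}" for y
    using C1_01_has_real_derivative[OF w_C1 that] by (simp add: w_def)
  have u: "continuous_on {0..1} u" "u 0 = 0"
    using assms(2,3) by (simp_all add: C1_01_def u_def)
  have N: "\<bar>v y\<bar> \<le> N" if "y \<in> {0..1}" for y
    unfolding N_def using abs_le_supnorm01[OF C1_01_imp_continuous_on[OF assms(2)] that] .
  have M: "\<bar>D01 w y\<bar> \<le> M" if "y \<in> {0..1}" for y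
    unfolding M_def using w_C1 that by (intro abs_le_supnorm01) (simp_all add: C1_01_def)
  have NM0: "N \<ge> 0" "M \<ge> 0"
    using N[of 0] M[of 0] by auto
  obtain x where x: "x \<in> {0..1}" "supnorm01 w = \<bar>w x\<bar>"
    using supnorm01_attained[OF C1_01_imp_continuous_on[OF w_C1]] by blast
  have "\<bar>w x\<bar> powr (p / (p - 1)) \<le> 2 * (p / (p - 1)) * N * M"
  proof (cases "u x" "0 :: real" rule: linorder_cases)
    case greater
    then have "w x > 0"
      by (simp add: w_def phi_pos_eq_powr)
    with phi_deriv_powr_le[OF assms(1) v' u w' N M x(1) greater] show ?thesis
      by (simp add: w_def)
  next
    case equal
    then show ?thesis
      using NM0 assms(1) by (simp add: w_def phi_def)
  next
    case less
    have "phi p (- u x) powr (p / (p - 1)) \<le> 2 * (p / (p - 1)) * N * M"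
    proof (rule phi_deriv_powr_le[where v = "\<lambda>y. - v y" and u = "\<lambda>y. - u y" and w' = "\<lambda>y. - D01 w y"])
      show "((\<lambda>y. phi p (- u y)) has_real_derivative - D01 w y) (at y within {0..1})"
        if "y \<in> {0..1}" for y
        unfolding phi_minus using w'[OF that] by (rule DERIV_minus)
    qed (use assms(1) v' u N M x less in \<open>auto intro!: DERIV_minus continuous_intros\<close>)
    moreover have "\<bar>w x\<bar> = phi p (- u x)"
      using less by (simp add: w_def phi_def abs_mult)
    ultimately show ?thesis
      by simp
  qed
  also have "\<dots> \<le> 4 * gam p * N * M"
    using conjugate_exponent_le_gam[OF assms(1)] NM0 by (intro mult_right_mono)
  finally show ?thesis
    using x(2) by (simp add: w_def u_def N_def M_def)
qed

end
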